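(* Let $G$ be a CCD with exactly two vertex color classes $R$ and $B$ such that the set of edge colors $\{\zeta_G((b,r)) : b\in B, r\in R\}$ equals $[\ell]=\{1,\dots,\ell\}$. For $b\in B$ let $A(b)=(P_1,\dots,P_\ell)$ with $P_i=\{r\in R:\zeta_G((b,r))=i\}$, let $\mathcal A=\{A(b):b\in B\}$, for $A\in\mathcal A$ let $X(A)=\{b\in B: A(b)=A\}$, and let $\mathcal B=\{X(A):A\in\mathcal A\}$. Then $G$ is ultrahomogeneous if and only if all of the following hold: (1) $G[R]$ and $G[B]$ are ultrahomogeneous; (2) $\mathcal A$ is an ultrahomogeneous system of partitions of $G[R]$; (3) $\mathcal B$ is a block system of $\mathrm{Aut}(G[B])$; (4) $\mathrm{Aut}(G[B])^{\mathcal B}=\{\widehat\varphi:\varphi\in\mathrm{Aut}(G[R])^{\mathcal A}\}$, where for a permutation $\varphi$ of $\mathcal A$ induced by an automorphism of $G[R]$, $\widehat\varphi:\mathcal B\to\mathcal B$ is given by $X(A)\mapsto X(\varphi(A))$; (5) $G[B]$ is easygoing with respect to $\mathcal B$.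
   Context: A complete colored digraph (CCD) $G$ consists of a finite non-empty vertex set $V(G)$, a vertex coloring $\chi_G$ and an edge coloring $\zeta_G$ on all ordered pairs of distinct vertices; $G[U]$ is the induced CCD on $U$. Isomorphisms preserve vertex and edge colors; $\mathrm{Aut}(G)$ is the automorphism group; a partial isomorphism is an isomorphism between induced sub-CCDs; $G$ is ultrahomogeneous if every partial isomorphism extends to an automorphism. A vertex color class is a maximal set of vertices of one color. For an ordered partition $A=(P_1,\dots,P_k)$ of $V(G)$ and $\varphi\in\mathrm{Aut}(G)$, $\varphi(A)=(\varphi(P_1),\dots,\varphi(P_k))$; $\mathrm{Aut}(G)$ thus acts on ordered partitions and $\mathrm{Aut}(G)^{\mathcal A}$ denotes the permutation group induced on an invariant set $\mathcal A$ of ordered partitions. For ordered partitions $A_1,\dots,A_k$, $\chi_G(A_1,\dots,A_k)$ is the vertex coloring $v\mapsto(\chi_G(v),i_1,\dots,i_k)$ where $v$ lies in the $i_j$-th part of $A_j$. Let $\mathcal A(A)=\{\varphi(A):\varphi\in\mathrm{Aut}(G)\}$. A set $\mathcal A$ is an ultrahomogeneous system of partitions of $G$ if $\mathcal A=\mathcal A(A)$ for an ordered partition $A$ such that for every finite sequence $A_1,\dots,A_m$ of elements of $\mathcal A(A)$, the CCD $G$ with vertex coloring replaced by $\chi_G(A_1,\dots,A_m)$ is ultrahomogeneous. A block system of a permutation group $\Gamma\le\mathrm{Sym}(V)$ is a partition of $V$ mapped to itself by every element of $\Gamma$; $\Gamma^{\mathcal B}$ is the induced permutation group on the set of blocks.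 A vertex-monochromatic CCD $H$ with block system $\mathcal B$ of $\mathrm{Aut}(H)$ is easygoing with respect to $\mathcal B$ if for every $\mathcal B'\subseteq\mathcal B$, the group induced on $\mathcal B$ by the pointwise stabilizer in $\mathrm{Aut}(H)$ of $\bigcup\mathcal B'=\bigcup_{X\in\mathcal B'}X$ equals the subgroup of $\mathrm{Aut}(H)^{\mathcal B}$ fixing every block of $\mathcal B'$.
   Formalization: Added assumption: for b,b' in B and r,r' in R, ζ(b,r)=ζ(b',r') implies ζ(r,b)=ζ(r',b'). Without it the claim fails: B={b}, R={r,r'}, all colors 1 except ζ(r',b)=2 satisfies (1)–(5), but r↦r' does not extend. *)

theory Defs
  imports
    Main
    "HOL-Library.FuncSet"
    "HOL-Library.Disjoint_Sets"
    "HOL-Combinatorics.Permutations"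
begin

text \<open>
  Both colorings are total functions, but only the values of \<open>vcol\<close> on vertices and the values of
  \<open>ecol\<close> on ordered pairs of distinct vertices are ever used.
\<close>

record ('v, 'c, 'e) ccd =
  verts :: "'v set"
  vcol :: "'v \<Rightarrow> 'c"
  ecol :: "'v \<times> 'v \<Rightarrow> 'e"

definition is_ccd :: "('v, 'c, 'e) ccd \<Rightarrow> bool" where
  "is_ccd G \<longleftrightarrow> finite (verts G) \<and> verts G \<noteq> {}"

definition induced :: "('v, 'c, 'e) ccd \<Rightarrow> 'v set \<Rightarrow> ('v, 'c, 'e) ccd" where
  "induced G U = G\<lparr>verts := U\<rparr>"

definition ccd_iso :: "('v, 'c, 'e) ccd \<Rightarrow> ('w, 'c, 'e) ccd \<Rightarrow> ('v \<Rightarrow> 'w) \<Rightarrow> bool" where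
  "ccd_iso G H f \<longleftrightarrow>
     bij_betw f (verts G) (verts H) \<and>
     (\<forall>v\<in>verts G. vcol H (f v) = vcol G v) \<and>
     (\<forall>u\<in>verts G. \<forall>v\<in>verts G. u \<noteq> v \<longrightarrow> ecol H (f u, f v) = ecol G (u, v))"

text \<open>
  \<open>permutes\<close> makes every automorphism the identity outside \<open>verts G\<close>, so that automorphisms
  which agree on the vertices are equal.
\<close>

definition Aut :: "('v, 'c, 'e) ccd \<Rightarrow> ('v \<Rightarrow> 'v) set" where
  "Aut G = {\<phi>. \<phi> permutes verts G \<and> ccd_iso G G \<phi>}"

definition partial_iso ::
  "('v, 'c, 'e) ccd \<Rightarrow> 'v set \<Rightarrow> 'v set \<Rightarrow> ('v \<Rightarrow> 'v) \<Rightarrow> bool" where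
  "partial_iso G U W f \<longleftrightarrow>
     U \<subseteq> verts G \<and> U \<noteq> {} \<and> W \<subseteq> verts G \<and> W \<noteq> {} \<and> ccd_iso (induced G U) (induced G W) f"

definition ultrahomogeneous :: "('v, 'c, 'e) ccd \<Rightarrow> bool" where
  "ultrahomogeneous G \<longleftrightarrow>
     (\<forall>U W f. partial_iso G U W f \<longrightarrow> (\<exists>\<phi>\<in>Aut G. \<forall>u\<in>U. \<phi> u = f u))"

definition vertex_color_classes :: "('v, 'c, 'e) ccd \<Rightarrow> 'v set set" where
  "vertex_color_classes G = (\<lambda>c. {v \<in> verts G. vcol G v = c}) ` vcol G ` verts G"

text \<open>
  Parts may be empty: a vertex \<open>b\<close> need not have an edge of every color, and its partition below
  should be an ordered partition all the same.
\<close>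

definition ordered_partition :: "'v set \<Rightarrow> 'v set list \<Rightarrow> bool" where
  "ordered_partition V P \<longleftrightarrow>
     \<Union> (set P) = V \<and>
     (\<forall>i<length P. \<forall>j<length P. i \<noteq> j \<longrightarrow> P ! i \<inter> P ! j = {})"

definition act_partition :: "('v \<Rightarrow> 'v) \<Rightarrow> 'v set list \<Rightarrow> 'v set list" where
  "act_partition \<phi> P = map (\<lambda>Q. \<phi> ` Q) P"

definition partition_orbit :: "('v, 'c, 'e) ccd \<Rightarrow> 'v set list \<Rightarrow> 'v set list set" where
  "partition_orbit G P = {act_partition \<phi> P | \<phi>. \<phi> \<in> Aut G}"

text \<open>Parts are counted from 0 here.\<close>

definition part_index :: "'v set list \<Rightarrow> 'v \<Rightarrow> nat" where
  "part_index P v = (THE i. i < length P \<and> v \<in> P ! i)"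

definition recolor :: "('v, 'c, 'e) ccd \<Rightarrow> 'v set list list \<Rightarrow> ('v, 'c \<times> nat list, 'e) ccd" where
  "recolor G Ps =
     \<lparr>verts = verts G, vcol = (\<lambda>v. (vcol G v, map (\<lambda>P. part_index P v) Ps)), ecol = ecol G\<rparr>"

definition ultrahomogeneous_system :: "('v, 'c, 'e) ccd \<Rightarrow> 'v set list set \<Rightarrow> bool" where
  "ultrahomogeneous_system G \<A> \<longleftrightarrow>
     (\<exists>P. ordered_partition (verts G) P \<and> \<A> = partition_orbit G P \<and>
          (\<forall>Ps. set Ps \<subseteq> partition_orbit G P \<longrightarrow> ultrahomogeneous (recolor G Ps)))"

text \<open>
  The permutations that \<open>\<Gamma>\<close> induces on an invariant set \<open>S\<close> through the action \<open>act\<close>,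
  as functions undefined outside \<open>S\<close>.
\<close>

definition induced_perms :: "('g \<Rightarrow> 's \<Rightarrow> 's) \<Rightarrow> 'g set \<Rightarrow> 's set \<Rightarrow> ('s \<Rightarrow> 's) set" where
  "induced_perms act \<Gamma> S = (\<lambda>\<phi>. restrict (act \<phi>) S) ` \<Gamma>"

definition block_system :: "'v set \<Rightarrow> ('v \<Rightarrow> 'v) set \<Rightarrow> 'v set set \<Rightarrow> bool" where
  "block_system V \<Gamma> \<B> \<longleftrightarrow> partition_on V \<B> \<and> (\<forall>\<phi>\<in>\<Gamma>. (\<lambda>Y. \<phi> ` Y) ` \<B> = \<B>)"

definition easygoing :: "('v, 'c, 'e) ccd \<Rightarrow> 'v set set \<Rightarrow> bool" where
  "easygoing H \<B> \<longleftrightarrow>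
     (\<forall>u\<in>verts H. \<forall>v\<in>verts H. vcol H u = vcol H v) \<and>
     block_system (verts H) (Aut H) \<B> \<and>
     (\<forall>\<B>'. \<B>' \<subseteq> \<B> \<longrightarrow>
        induced_perms image {\<phi> \<in> Aut H. \<forall>v\<in>\<Union>\<B>'. \<phi> v = v} \<B> =
        {\<sigma> \<in> induced_perms image (Aut H) \<B>. \<forall>Y\<in>\<B>'. \<sigma> Y = Y})"

text \<open>
  The notions for two color classes \<open>R\<close> and \<open>B\<close>: \<open>nbr_partition G R l b\<close> is \<open>A(b)\<close> and
  \<open>nbr_class G R B l P\<close> is \<open>X(P)\<close>.
\<close>

definition nbr_partition :: "('v, 'c, nat) ccd \<Rightarrow> 'v set \<Rightarrow> nat \<Rightarrow> 'v \<Rightarrow> 'v set list" where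
  "nbr_partition G R l b = map (\<lambda>i. {r \<in> R. ecol G (b, r) = i}) [1..<Suc l]"

definition nbr_class ::
  "('v, 'c, nat) ccd \<Rightarrow> 'v set \<Rightarrow> 'v set \<Rightarrow> nat \<Rightarrow> 'v set list \<Rightarrow> 'v set" where
  "nbr_class G R B l P = {b \<in> B. nbr_partition G R l b = P}"

text \<open>
  \<open>hat X \<A> \<phi>\<close> is the map \<open>X P \<mapsto> X (\<phi> P)\<close> on \<open>X ` \<A>\<close>. It is meant
  for \<open>X\<close> injective on \<open>\<A>\<close>, which holds for \<open>X = nbr_class G R B l\<close> and
  \<open>\<A> = nbr_partition G R l ` B\<close>, as distinct partitions have disjoint non-empty classes.
\<close>

definition hat :: "('p \<Rightarrow> 'b) \<Rightarrow> 'p set \<Rightarrow> ('p \<Rightarrow> 'p) \<Rightarrow> 'b \<Rightarrow> 'b" where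
  "hat X \<A> \<phi> = restrict (\<lambda>Y. X (\<phi> (inv_into \<A> X Y))) (X ` \<A>)"

text \<open>
  The color of an edge from \<open>B\<close> to \<open>R\<close> determines the color of the reverse edge. The partitions
  \<open>nbr_partition G R l b\<close> see only the edges from \<open>B\<close> to \<open>R\<close>, so some such convention is needed:
  if \<open>B = {b}\<close>, \<open>R\<close> consists of two vertices \<open>r\<close>, \<open>r'\<close> that an automorphism of \<open>G[R]\<close> exchanges,
  \<open>(b, r)\<close> and \<open>(b, r')\<close> have the same color and \<open>(r, b)\<close> and \<open>(r', b)\<close> do not, then \<open>G\<close> is not
  ultrahomogeneous although nothing can be seen from \<open>G[R]\<close>, \<open>G[B]\<close> and the partitions.
\<close>

definition reverse_determined :: "('v, 'c, 'e) ccd \<Rightarrow> 'v set \<Rightarrow> 'v set \<Rightarrow> bool" where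
  "reverse_determined G B R \<longleftrightarrow>
     (\<forall>b\<in>B. \<forall>b'\<in>B. \<forall>r\<in>R. \<forall>r'\<in>R.
        ecol G (b, r) = ecol G (b', r') \<longrightarrow> ecol G (r, b) = ecol G (r', b'))"

end

theory Submission
  imports Defs
begin

text \<open>
  As the reverse colors are determined, automorphisms \<open>\<rho>\<close> of \<open>G[R]\<close> and \<open>\<beta>\<close> of \<open>G[B]\<close> glue to an
  automorphism of \<open>G\<close> exactly if \<open>\<rho>(A(b)) = A(\<beta>(b))\<close> for all \<open>b\<close>; call such a pair compatible.
  Condition (4) says that every \<open>\<rho>\<close> and every \<open>\<beta>\<close> belongs to a compatible pair. If \<open>G\<close> is
  ultrahomogeneous, all conditions follow by extending suitable partial isomorphisms. Conversely,
  given a partial isomorphism \<open>f\<close>, extend its part in \<open>B\<close> to \<open>\<beta>\<close> and pick a compatible \<open>\<rho>\<close>. On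
  \<open>R\<close>, the map \<open>\<rho>\<inverse> \<circ> f\<close> preserves the partitions \<open>A(b)\<close> for \<open>b\<close> in the domain of \<open>f\<close>, so by (2)
  it extends to an automorphism \<open>\<tau>\<close> fixing these partitions. By (4) and (5), \<open>\<tau>\<close> is compatible with
  some \<open>\<delta>\<close> that fixes these \<open>b\<close>. Then \<open>\<rho> \<circ> \<tau>\<close> and \<open>\<beta> \<circ> \<delta>\<close> glue to an extension of \<open>f\<close>.
\<close>

section \<open>Extending embeddings\<close>

text \<open>
  Replacing a partial isomorphism by an embedding of a possibly empty vertex set removes the
  target set and the non-emptiness conditions.
\<close>

definition embeds :: "('v, 'c, 'e) ccd \<Rightarrow> 'v set \<Rightarrow> ('v \<Rightarrow> 'v) \<Rightarrow> bool" where
  "embeds G U f \<longleftrightarrow>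
     U \<subseteq> verts G \<and> f ` U \<subseteq> verts G \<and> inj_on f U \<and>
     (\<forall>u\<in>U. vcol G (f u) = vcol G u) \<and>
     (\<forall>u\<in>U. \<forall>v\<in>U. u \<noteq> v \<longrightarrow> ecol G (f u, f v) = ecol G (u, v))"

lemma induced_sel [simp]:
  "verts (induced G U) = U" "vcol (induced G U) = vcol G" "ecol (induced G U) = ecol G"
  by (simp_all add: induced_def)

lemma embedsD:
  assumes "embeds G U f"
  shows "u \<in> U \<Longrightarrow> f u \<in> verts G"
    and "u \<in> U \<Longrightarrow> vcol G (f u) = vcol G u"
    and "u \<in> U \<Longrightarrow> v \<in> U \<Longrightarrow> u \<noteq> v \<Longrightarrow> ecol G (f u, f v) = ecol G (u, v)"
  using assms by (auto simp: embeds_def)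

lemma Aut_iff_embeds: "\<phi> \<in> Aut G \<longleftrightarrow> \<phi> permutes verts G \<and> embeds G (verts G) \<phi>"
  by (auto simp: Aut_def ccd_iso_def embeds_def permutes_imp_bij bij_betw_def
      permutes_inj_on permutes_image)

lemma partial_iso_iff_embeds:
  "partial_iso G U W f \<longleftrightarrow> embeds G U f \<and> U \<noteq> {} \<and> W = f ` U"
  by (auto simp: partial_iso_def ccd_iso_def embeds_def bij_betw_def)

lemma Aut_id: "id \<in> Aut G"
  by (simp add: Aut_iff_embeds embeds_def permutes_id)

text \<open>The empty domain adds no condition, as the identity extends every map on it.\<close>

lemma ultrahomogeneous_iff_embeds:
  "ultrahomogeneous G \<longleftrightarrow> (\<forall>U f. embeds G U f \<longrightarrow> (\<exists>\<phi>\<in>Aut G. \<forall>u\<in>U. \<phi> u = f u))"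
  unfolding ultrahomogeneous_def partial_iso_iff_embeds using Aut_id by blast

lemma Aut_permutes: "\<phi> \<in> Aut G \<Longrightarrow> \<phi> permutes verts G"
  by (simp add: Aut_iff_embeds)

lemma Aut_embeds: "\<phi> \<in> Aut G \<Longrightarrow> U \<subseteq> verts G \<Longrightarrow> embeds G U \<phi>"
  unfolding Aut_iff_embeds embeds_def by (blast intro: inj_on_subset)

lemma embeds_comp: "embeds G U f \<Longrightarrow> embeds G (f ` U) g \<Longrightarrow> embeds G U (g \<circ> f)"
  by (auto simp: embeds_def comp_inj_on inj_on_eq_iff)

lemma embeds_cong: "(\<And>u. u \<in> U \<Longrightarrow> f u = g u) \<Longrightarrow> embeds G U f \<longleftrightarrow> embeds G U g"
  by (auto simp: embeds_def cong: inj_on_cong)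

lemma Aut_comp: "\<phi> \<in> Aut G \<Longrightarrow> \<psi> \<in> Aut G \<Longrightarrow> \<phi> \<circ> \<psi> \<in> Aut G"
  using embeds_comp[of G "verts G" \<psi> \<phi>]
  by (auto simp: Aut_iff_embeds permutes_compose permutes_image)

lemma Aut_inv:
  assumes "\<phi> \<in> Aut G"
  shows "inv \<phi> \<in> Aut G"
proof -
  have p: "\<phi> permutes verts G" and e: "embeds G (verts G) \<phi>"
    using assms by (auto simp: Aut_iff_embeds)
  have q: "inv \<phi> permutes verts G" using p by (rule permutes_inv)
  have in_V: "inv \<phi> v \<in> verts G" if "v \<in> verts G" for v
    using that permutes_in_image[OF q] by simp
  have "vcol G (inv \<phi> v) = vcol G v" if "v \<in> verts G" for v
    using embedsD(2)[OF e in_V[OF that]] by (simp add: permutes_inverses(1)[OF p])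
  moreover have "ecol G (inv \<phi> u, inv \<phi> v) = ecol G (u, v)"
    if "u \<in> verts G" "v \<in> verts G" "u \<noteq> v" for u v
  proof -
    have "inv \<phi> u \<noteq> inv \<phi> v" using that(3) by (simp add: inj_eq[OF permutes_inj[OF q]])
    then show ?thesis
      using embedsD(3)[OF e in_V[OF that(1)] in_V[OF that(2)]]
      by (simp add: permutes_inverses(1)[OF p])
  qed
  ultimately show ?thesis
    using q by (auto simp: Aut_iff_embeds embeds_def permutes_inj_on in_V)
qed

section \<open>Recoloring by ordered partitions\<close>

lemma embeds_recolor:
  "embeds (recolor G Ps) U f \<longleftrightarrow>
     embeds G U f \<and> (\<forall>P\<in>set Ps. \<forall>u\<in>U. part_index P (f u) = part_index P u)"
  by (auto simp: embeds_def recolor_def)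

lemma Aut_recolor:
  "\<phi> \<in> Aut (recolor G Ps) \<longleftrightarrow>
     \<phi> \<in> Aut G \<and> (\<forall>P\<in>set Ps. \<forall>v\<in>verts G. part_index P (\<phi> v) = part_index P v)"
proof -
  have "verts (recolor G Ps) = verts G" by (simp add: recolor_def)
  then show ?thesis by (auto simp: Aut_iff_embeds embeds_recolor)
qed

section \<open>Permutations of a set and of a disjoint union\<close>

lemma permutes_fix_outside:
  assumes "\<phi> permutes V" "\<phi> ` S = S"
  shows "(\<lambda>v. if v \<in> S then \<phi> v else v) permutes S"
proof (rule bij_imp_permutes)
  have "bij_betw \<phi> S S"
    using assms(2) permutes_inj_on[OF assms(1)] by (simp add: bij_betw_def)
  then show "bij_betw (\<lambda>v. if v \<in> S then \<phi> v else v) S S"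
    by (rule bij_betw_cong[THEN iffD1, rotated]) simp
qed simp

text \<open>Each factor is the identity off its own set and the sets are disjoint, so the case
  distinction is just the composition \<open>\<rho> \<circ> \<beta>\<close>.\<close>

lemma permutes_glue:
  assumes "\<rho> permutes R" "\<beta> permutes B" "R \<inter> B = {}"
  shows "(\<lambda>v. if v \<in> R then \<rho> v else \<beta> v) permutes (R \<union> B)"
proof -
  have "(\<lambda>v. if v \<in> R then \<rho> v else \<beta> v) = \<rho> \<circ> \<beta>"
  proof
    fix v
    show "(if v \<in> R then \<rho> v else \<beta> v) = (\<rho> \<circ> \<beta>) v"
    proof (cases "v \<in> R")
      case True
      then have "v \<notin> B" using assms(3) by blast
      then show ?thesis using True permutes_not_in[OF assms(2)] by simp
    next
      case False
      have "\<beta> v \<notin> R"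
      proof (cases "v \<in> B")
        case True
        then show ?thesis using permutes_in_image[OF assms(2), of v] assms(3) by blast
      next
        case v: False
        then show ?thesis using permutes_not_in[OF assms(2) v] False by simp
      qed
      then show ?thesis using False permutes_not_in[OF assms(1)] by simp
    qed
  qed
  moreover have "\<rho> \<circ> \<beta> permutes (R \<union> B)"
    using assms by (meson permutes_compose permutes_subset sup_ge1 sup_ge2)
  ultimately show ?thesis by simp
qed

lemma permutes_eqI:
  assumes "f permutes S" "g permutes S" "\<And>x. x \<in> S \<Longrightarrow> f x = g x"
  shows "f = g"
proof
  show "f x = g x" for x
    using assms(3) permutes_not_in[OF assms(1)] permutes_not_in[OF assms(2)]
    by (cases "x \<in> S") simp_all
qed

lemma inj_act_partition:
  assumes "\<rho> permutes V"
  shows "inj (act_partition \<rho>)"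
proof -
  have "inj ((`) \<rho>)" using assms by (simp add: inj_image_eq_iff inj_def[of "(`) \<rho>"] permutes_inj)
  then show ?thesis unfolding act_partition_def[abs_def] by simp
qed

section \<open>Two vertex color classes\<close>

locale two_class_ccd =
  fixes G :: "('v, 'c, nat) ccd" and R B :: "'v set" and l :: nat
  assumes verts_eq: "verts G = R \<union> B"
    and disj: "R \<inter> B = {}"
    and B_nonempty: "B \<noteq> {}"
    and vcol_eq_iff:
      "u \<in> R \<union> B \<Longrightarrow> v \<in> R \<union> B \<Longrightarrow> vcol G u = vcol G v \<longleftrightarrow> (u \<in> R \<longleftrightarrow> v \<in> R)"
    and ecol_range: "b \<in> B \<Longrightarrow> r \<in> R \<Longrightarrow> ecol G (b, r) \<in> {1..l}"
    and reverse: "reverse_determined G B R"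
begin

abbreviation N :: "'v \<Rightarrow> 'v set list" where "N \<equiv> nbr_partition G R l"
abbreviation X :: "'v set list \<Rightarrow> 'v set" where "X \<equiv> nbr_class G R B l"
abbreviation \<A> :: "'v set list set" where "\<A> \<equiv> N ` B"
abbreviation \<B> :: "'v set set" where "\<B> \<equiv> X ` \<A>"

definition compatible :: "('v \<Rightarrow> 'v) \<Rightarrow> ('v \<Rightarrow> 'v) \<Rightarrow> bool" where
  "compatible \<rho> \<beta> \<longleftrightarrow> (\<forall>b\<in>B. act_partition \<rho> (N b) = N (\<beta> b))"

lemma not_R: "b \<in> B \<Longrightarrow> b \<notin> R"
  using disj by blast

section \<open>Neighbor partitions and edge colors\<close>

lemma nth_nbr_partition: "i < l \<Longrightarrow> N b ! i = {r \<in> R. ecol G (b, r) = Suc i}"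
  by (simp add: nbr_partition_def nth_append del: upt_Suc)

lemma length_nbr_partition: "length (N b) = l"
  by (simp add: nbr_partition_def)

text \<open>The parts of \<open>N b\<close> are the fibers of the coloring of the edges from
  \<open>b\<close> to \<open>R\<close>. A permutation of \<open>R\<close> carries the fibers for
  \<open>b\<close> to those for \<open>b'\<close>, color by color, exactly if it turns one coloring
  into the other.\<close>

lemma act_nbr_partition_eq_iff:
  assumes "\<rho> permutes R" "b \<in> B" "b' \<in> B"
  shows "act_partition \<rho> (N b) = N b' \<longleftrightarrow> (\<forall>r\<in>R. ecol G (b', \<rho> r) = ecol G (b, r))"
proof
  assume eq: "act_partition \<rho> (N b) = N b'"
  show "\<forall>r\<in>R. ecol G (b', \<rho> r) = ecol G (b, r)"
  proof
    fix r assume r: "r \<in> R"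
    \<comment> \<open>Colors start at 1 and list positions at 0, so color \<open>Suc i\<close> sits
      at position \<open>i\<close>.\<close>
    define i where "i = ecol G (b, r) - 1"
    have i: "i < l" "ecol G (b, r) = Suc i"
      using ecol_range[OF assms(2) r] by (auto simp: i_def)
    have "\<rho> ` (N b ! i) = N b' ! i"
      using eq i(1) by (metis act_partition_def length_nbr_partition nth_map)
    moreover have "r \<in> N b ! i" using r i by (simp add: nth_nbr_partition)
    ultimately have "\<rho> r \<in> N b' ! i" by blast
    then show "ecol G (b', \<rho> r) = ecol G (b, r)" using i by (simp add: nth_nbr_partition)
  qed
next
  assume *: "\<forall>r\<in>R. ecol G (b', \<rho> r) = ecol G (b, r)"
  have "\<rho> ` {r \<in> R. ecol G (b, r) = i} = {r \<in> R. ecol G (b', r) = i}" for i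
  proof -
    have "{r \<in> R. ecol G (b', r) = i} = {s \<in> \<rho> ` R. ecol G (b', s) = i}"
      by (simp add: permutes_image[OF assms(1)])
    also have "\<dots> = \<rho> ` {r \<in> R. ecol G (b', \<rho> r) = i}" by blast
    also have "{r \<in> R. ecol G (b', \<rho> r) = i} = {r \<in> R. ecol G (b, r) = i}" using * by auto
    finally show ?thesis by simp
  qed
  then show "act_partition \<rho> (N b) = N b'"
    by (simp add: act_partition_def nbr_partition_def)
qed

lemma compatible_iff:
  assumes "\<rho> permutes R" "\<beta> permutes B"
  shows "compatible \<rho> \<beta> \<longleftrightarrow> (\<forall>b\<in>B. \<forall>r\<in>R. ecol G (\<beta> b, \<rho> r) = ecol G (b, r))"
  using assms by (simp add: compatible_def act_nbr_partition_eq_iff permutes_in_image)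

text \<open>Colors are at least 1, so the subtraction on natural numbers does not truncate; the
  position is unique because an edge has only one color.\<close>

lemma part_index_nbr_partition:
  assumes "b \<in> B" "r \<in> R"
  shows "part_index (N b) r = ecol G (b, r) - 1"
  unfolding part_index_def
  by (rule the_equality)
    (use assms ecol_range[OF assms] in \<open>auto simp: nth_nbr_partition length_nbr_partition\<close>)

text \<open>Turns the vertex colors added by \<open>recolor\<close> into colors of edges leaving
  \<open>b\<close>; subtracting 1 is injective on \<open>{1..l}\<close>.\<close>

lemma part_index_eq_iff:
  assumes "b \<in> B" "r \<in> R" "r' \<in> R"
  shows "part_index (N b) r' = part_index (N b) r \<longleftrightarrow> ecol G (b, r') = ecol G (b, r)"
  using ecol_range[OF assms(1,2)] ecol_range[OF assms(1,3)] assms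
  by (auto simp: part_index_nbr_partition)

lemma ordered_partition_nbr_partition:
  assumes "b \<in> B"
  shows "ordered_partition R (N b)"
proof -
  have "\<Union> (set (N b)) = R"
    using ecol_range[OF assms] by (fastforce simp: nbr_partition_def simp del: upt_Suc)
  then show ?thesis
    by (auto simp: ordered_partition_def length_nbr_partition nth_nbr_partition)
qed

section \<open>Blocks and compatible pairs\<close>

lemma mem_nbr_class: "b \<in> X (N b') \<longleftrightarrow> b \<in> B \<and> N b = N b'"
  by (simp add: nbr_class_def)

lemma inj_on_nbr_class: "inj_on X \<A>"
  by (auto simp: inj_on_def nbr_class_def)

text \<open>The blocks are the non-empty fibers of \<open>N\<close> on \<open>B\<close>.\<close>

lemma partition_on_blocks: "partition_on B \<B>"
  by (rule partition_onI) (auto simp: nbr_class_def disjnt_def)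

text \<open>Compatibility gives \<open>N (\<beta> b') = act_partition \<rho> (N b')\<close>, and
  \<open>\<rho>\<close> acts injectively on partitions. Hence \<open>\<beta>\<close> preserves and
  reflects equality of partitions and maps fibers of \<open>N\<close> onto fibers.\<close>

lemma image_nbr_class:
  assumes "\<rho> permutes R" "\<beta> permutes B" "compatible \<rho> \<beta>" "b \<in> B"
  shows "\<beta> ` X (N b) = X (N (\<beta> b))"
proof -
  have eq: "N (\<beta> b') = N (\<beta> b) \<longleftrightarrow> N b' = N b" if "b' \<in> B" for b'
  proof -
    have "N (\<beta> b') = act_partition \<rho> (N b')" "N (\<beta> b) = act_partition \<rho> (N b)"
      using assms(3,4) that by (simp_all add: compatible_def)
    then show ?thesis by (simp add: inj_eq[OF inj_act_partition[OF assms(1)]])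
  qed
  have "X (N (\<beta> b)) = {c \<in> \<beta> ` B. N c = N (\<beta> b)}"
    by (simp add: nbr_class_def permutes_image[OF assms(2)])
  also have "\<dots> = \<beta> ` {b' \<in> B. N (\<beta> b') = N (\<beta> b)}" by blast
  also have "{b' \<in> B. N (\<beta> b') = N (\<beta> b)} = X (N b)"
    using eq by (auto simp: nbr_class_def)
  finally show ?thesis by simp
qed

text \<open>Condition (4) for a single pair. It also shows that the action of \<open>\<beta>\<close>
  on the blocks is all that compatibility with \<open>\<rho>\<close> depends on.\<close>

lemma hat_eq_iff_compatible:
  assumes "\<rho> permutes R" "\<beta> permutes B"
  shows "hat X \<A> (restrict (act_partition \<rho>) \<A>) = restrict ((`) \<beta>) \<B> \<longleftrightarrow> compatible \<rho> \<beta>"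
    (is "?h = _ \<longleftrightarrow> _")
proof -
  \<comment> \<open>\<open>X\<close> is injective on \<open>\<A>\<close>, so the inverse inside
    \<open>hat\<close> recovers \<open>N b\<close> from its class.\<close>
  have h: "?h (X (N b)) = X (act_partition \<rho> (N b))" if "b \<in> B" for b
    using that inv_into_f_f[OF inj_on_nbr_class, of "N b"] by (simp add: hat_def)
  show ?thesis
  proof
    assume eq: "?h = restrict ((`) \<beta>) \<B>"
    show "compatible \<rho> \<beta>"
      unfolding compatible_def
    proof
      fix b assume b: "b \<in> B"
      have "X (act_partition \<rho> (N b)) = \<beta> ` X (N b)"
        using h[OF b] b by (simp add: eq)
      \<comment> \<open>\<open>b\<close> lies in its own class, so \<open>\<beta> b\<close> lies in
        the image of that class, and membership there reveals the partition of
        \<open>\<beta> b\<close>.\<close>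
      then have "\<beta> b \<in> X (act_partition \<rho> (N b))" using b by (simp add: mem_nbr_class)
      then show "act_partition \<rho> (N b) = N (\<beta> b)" by (simp add: nbr_class_def)
    qed
  next
    assume c: "compatible \<rho> \<beta>"
    show "?h = restrict ((`) \<beta>) \<B>"
    proof
      fix Y
      show "?h Y = restrict ((`) \<beta>) \<B> Y"
      \<comment> \<open>Outside \<open>\<B>\<close> both restricted functions are
        \<open>undefined\<close>.\<close>
      proof (cases "Y \<in> \<B>")
        case True
        then obtain b where "b \<in> B" "Y = X (N b)" by blast
        then show ?thesis
          using c h image_nbr_class[OF assms c] True by (simp add: compatible_def)
      qed (simp add: hat_def)
    qed
  qed
qed

section \<open>Splitting and gluing along the two classes\<close>

lemma ecol_reverse:
  "b \<in> B \<Longrightarrow> b' \<in> B \<Longrightarrow> r \<in> R \<Longrightarrow> r' \<in> R \<Longrightarrow> ecol G (b', r') = ecol G (b, r) \<Longrightarrow>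
     ecol G (r', b') = ecol G (r, b)"
  using reverse unfolding reverse_determined_def by blast

lemma embeds_classes:
  assumes "embeds G U f"
  shows "f ` (U \<inter> R) \<subseteq> R" "f ` (U \<inter> B) \<subseteq> B"
proof -
  have "u \<in> R \<union> B" "f u \<in> R \<union> B" "vcol G (f u) = vcol G u" if "u \<in> U" for u
    using assms that by (auto simp: embeds_def verts_eq)
  then show "f ` (U \<inter> R) \<subseteq> R" "f ` (U \<inter> B) \<subseteq> B"
    using vcol_eq_iff not_R by blast+
qed

text \<open>Vertex colors keep the two classes apart, so the restrictions to them interact only
  through edges between \<open>B\<close> and \<open>R\<close>. It suffices to check the direction
  from \<open>B\<close> to \<open>R\<close>, as it determines the reverse colors. Injectivity is
  inherited because the two images lie in disjoint classes.\<close>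

lemma embeds_iff:
  assumes "U \<subseteq> R \<union> B"
  shows "embeds G U f \<longleftrightarrow>
    embeds (induced G R) (U \<inter> R) f \<and> embeds (induced G B) (U \<inter> B) f \<and>
    (\<forall>b\<in>U \<inter> B. \<forall>r\<in>U \<inter> R. ecol G (f b, f r) = ecol G (b, r))"
proof (intro iffI conjI)
  assume e: "embeds G U f"
  show "embeds (induced G R) (U \<inter> R) f" "embeds (induced G B) (U \<inter> B) f"
    using e embeds_classes[OF e] by (auto simp: embeds_def inj_on_def)
  show "\<forall>b\<in>U \<inter> B. \<forall>r\<in>U \<inter> R. ecol G (f b, f r) = ecol G (b, r)"
    using embedsD(3)[OF e] not_R by blast
next
  assume *: "embeds (induced G R) (U \<inter> R) f \<and> embeds (induced G B) (U \<inter> B) f \<and>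
    (\<forall>b\<in>U \<inter> B. \<forall>r\<in>U \<inter> R. ecol G (f b, f r) = ecol G (b, r))"
  have eR: "embeds (induced G R) (U \<inter> R) f" and eB: "embeds (induced G B) (U \<inter> B) f"
    and cross: "\<And>b r. b \<in> U \<inter> B \<Longrightarrow> r \<in> U \<inter> R \<Longrightarrow> ecol G (f b, f r) = ecol G (b, r)"
    using * by blast+
  have fR: "f u \<in> R" if "u \<in> U" "u \<in> R" for u using embedsD(1)[OF eR, of u] that by simp
  have fB: "f u \<in> B" if "u \<in> U" "u \<in> B" for u using embedsD(1)[OF eB, of u] that by simp
  have U: "u \<in> R \<or> u \<in> B" if "u \<in> U" for u using assms that by blast
  have "inj_on f U"
  proof -
    have "inj_on f (U \<inter> R)" "inj_on f (U \<inter> B)" using eR eB by (simp_all add: embeds_def)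
    moreover have "f ` (U \<inter> R - U \<inter> B) \<subseteq> R" "f ` (U \<inter> B - U \<inter> R) \<subseteq> B"
      using fR fB by auto
    then have "f ` (U \<inter> R - U \<inter> B) \<inter> f ` (U \<inter> B - U \<inter> R) = {}" using disj by fast
    ultimately have "inj_on f (U \<inter> R \<union> U \<inter> B)" by (simp add: inj_on_Un)
    moreover have "U = U \<inter> R \<union> U \<inter> B" using U by auto
    ultimately show ?thesis by simp
  qed
  moreover have "vcol G (f u) = vcol G u" if "u \<in> U" for u
    using U[OF that] embedsD(2)[OF eR, of u] embedsD(2)[OF eB, of u] that by auto
  moreover have "ecol G (f u, f v) = ecol G (u, v)" if "u \<in> U" "v \<in> U" "u \<noteq> v" for u v
  proof -
    have rev: "ecol G (f r, f b) = ecol G (r, b)" if "b \<in> U \<inter> B" "r \<in> U \<inter> R" for b r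
      using cross[OF that] ecol_reverse[of b "f b" r "f r"] fR fB that by simp
    show ?thesis
      using U[OF that(1)] U[OF that(2)] that embedsD(3)[OF eR, of u v] embedsD(3)[OF eB, of u v]
        cross[of u v] rev[of v u]
      by auto
  qed
  ultimately show "embeds G U f"
    using fR fB U assms by (auto simp: embeds_def verts_eq)
qed

lemma Aut_glue:
  assumes "\<rho> \<in> Aut (induced G R)" "\<beta> \<in> Aut (induced G B)" "compatible \<rho> \<beta>"
  shows "(\<lambda>v. if v \<in> R then \<rho> v else \<beta> v) \<in> Aut G" (is "?g \<in> _")
proof -
  have p: "\<rho> permutes R" "\<beta> permutes B" using assms(1,2) by (auto dest: Aut_permutes)
  have "(R \<union> B) \<inter> R = R" "(R \<union> B) \<inter> B = B" by auto
  moreover have "embeds (induced G R) R ?g"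
    using Aut_embeds[OF assms(1), of R] embeds_cong[of R ?g \<rho> "induced G R"] by simp
  moreover have "embeds (induced G B) B ?g"
    using Aut_embeds[OF assms(2), of B] embeds_cong[of B ?g \<beta> "induced G B"] not_R by simp
  moreover have "ecol G (?g b, ?g r) = ecol G (b, r)" if "b \<in> B" "r \<in> R" for b r
    using assms(3) that not_R by (simp add: compatible_iff[OF p])
  ultimately show ?thesis
    using permutes_glue[OF p disj] by (simp add: Aut_iff_embeds verts_eq embeds_iff)
qed

lemma Aut_split:
  assumes "\<phi> \<in> Aut G"
  obtains \<rho> \<beta> where "\<rho> \<in> Aut (induced G R)" "\<beta> \<in> Aut (induced G B)" "compatible \<rho> \<beta>"
    "\<And>r. r \<in> R \<Longrightarrow> \<rho> r = \<phi> r" "\<And>b. b \<in> B \<Longrightarrow> \<beta> b = \<phi> b"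
proof -
  \<comment> \<open>Members of \<open>Aut\<close> are the identity outside their vertex set, so the
    restrictions of \<open>\<phi>\<close> are completed by the identity.\<close>
  let ?\<rho> = "\<lambda>v. if v \<in> R then \<phi> v else v" and ?\<beta> = "\<lambda>v. if v \<in> B then \<phi> v else v"
  have p: "\<phi> permutes (R \<union> B)" and e: "embeds G (R \<union> B) \<phi>"
    using assms by (auto simp: Aut_iff_embeds verts_eq)
  have i: "(R \<union> B) \<inter> R = R" "(R \<union> B) \<inter> B = B" by auto
  have "\<phi> ` R \<subseteq> R" "\<phi> ` B \<subseteq> B" "\<phi> ` R \<union> \<phi> ` B = R \<union> B"
    using embeds_classes[OF e] permutes_image[OF p] by (simp_all add: i image_Un)
  \<comment> \<open>Subsets of two disjoint classes that together cover everything are the whole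
    classes, so \<open>\<phi>\<close> maps each class onto itself.\<close>
  moreover have "S = R \<and> T = B" if "S \<subseteq> R" "T \<subseteq> B" "S \<union> T = R \<union> B" for S T
    using that disj by blast
  ultimately have im: "\<phi> ` R = R" "\<phi> ` B = B" by simp_all
  have q: "?\<rho> permutes R" "?\<beta> permutes B"
    using permutes_fix_outside[OF p] im by simp_all
  have "embeds (induced G R) R \<phi>" "embeds (induced G B) B \<phi>"
    and "\<forall>b\<in>B. \<forall>r\<in>R. ecol G (\<phi> b, \<phi> r) = ecol G (b, r)"
    using e by (simp_all add: embeds_iff i)
  moreover have "embeds (induced G R) R ?\<rho> = embeds (induced G R) R \<phi>"
    "embeds (induced G B) B ?\<beta> = embeds (induced G B) B \<phi>"
    by (rule embeds_cong; simp)+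
  ultimately have "?\<rho> \<in> Aut (induced G R)" "?\<beta> \<in> Aut (induced G B)" "compatible ?\<rho> ?\<beta>"
    using q by (simp_all add: Aut_iff_embeds compatible_iff)
  then show thesis by (rule that) simp_all
qed

text \<open>Automorphisms of \<open>G\<close> correspond to compatible pairs by
  \<open>Aut_split\<close> and \<open>Aut_glue\<close>. Both directions of the theorem work with
  this form.\<close>

lemma ultrahomogeneous_iff_compatible:
  "ultrahomogeneous G \<longleftrightarrow>
     (\<forall>U f. embeds G U f \<longrightarrow>
        (\<exists>\<rho>\<in>Aut (induced G R). \<exists>\<beta>\<in>Aut (induced G B). compatible \<rho> \<beta> \<and>
           (\<forall>r\<in>U \<inter> R. \<rho> r = f r) \<and> (\<forall>b\<in>U \<inter> B. \<beta> b = f b)))"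
  (is "_ \<longleftrightarrow> ?P")
proof
  assume uh: "ultrahomogeneous G"
  show ?P
  proof (intro allI impI)
    fix U f assume "embeds G U f"
    then obtain \<phi> where \<phi>: "\<phi> \<in> Aut G" "\<forall>u\<in>U. \<phi> u = f u"
      using uh unfolding ultrahomogeneous_iff_embeds by blast
    obtain \<rho> \<beta> where "\<rho> \<in> Aut (induced G R)" "\<beta> \<in> Aut (induced G B)" "compatible \<rho> \<beta>"
      "\<And>r. r \<in> R \<Longrightarrow> \<rho> r = \<phi> r" "\<And>b. b \<in> B \<Longrightarrow> \<beta> b = \<phi> b"
      using Aut_split[OF \<phi>(1)] by metis
    with \<phi>(2) show "\<exists>\<rho>\<in>Aut (induced G R). \<exists>\<beta>\<in>Aut (induced G B). compatible \<rho> \<beta> \<and>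
        (\<forall>r\<in>U \<inter> R. \<rho> r = f r) \<and> (\<forall>b\<in>U \<inter> B. \<beta> b = f b)" by (metis IntD1 IntD2)
  qed
next
  assume P: ?P
  show "ultrahomogeneous G"
    unfolding ultrahomogeneous_iff_embeds
  proof (intro allI impI)
    fix U f assume e: "embeds G U f"
    then obtain \<rho> \<beta> where *: "\<rho> \<in> Aut (induced G R)" "\<beta> \<in> Aut (induced G B)"
      "compatible \<rho> \<beta>" "\<forall>r\<in>U \<inter> R. \<rho> r = f r" "\<forall>b\<in>U \<inter> B. \<beta> b = f b"
      using P by blast
    have "U \<subseteq> R \<union> B" using e by (simp add: embeds_def verts_eq)
    then have "\<forall>u\<in>U. (if u \<in> R then \<rho> u else \<beta> u) = f u" using *(4,5) by auto
    then show "\<exists>\<phi>\<in>Aut G. \<forall>u\<in>U. \<phi> u = f u"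
      by (rule bexI[OF _ Aut_glue[OF *(1-3)]])
  qed
qed

text \<open>Both sides are images of automorphism groups. Such images coincide iff every element of
  either group has a partner with the same value in the other, and by
  \<open>hat_eq_iff_compatible\<close> partners are compatible pairs.\<close>

lemma induced_perms_eq_iff:
  "induced_perms image (Aut (induced G B)) \<B> =
     {hat X \<A> \<phi> | \<phi>. \<phi> \<in> induced_perms act_partition (Aut (induced G R)) \<A>} \<longleftrightarrow>
   (\<forall>\<beta>\<in>Aut (induced G B). \<exists>\<rho>\<in>Aut (induced G R). compatible \<rho> \<beta>) \<and>
   (\<forall>\<rho>\<in>Aut (induced G R). \<exists>\<beta>\<in>Aut (induced G B). compatible \<rho> \<beta>)"
proof -
  have c: "compatible \<rho> \<beta> \<longleftrightarrow>
      restrict ((`) \<beta>) \<B> = hat X \<A> (restrict (act_partition \<rho>) \<A>)"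
    if "\<rho> \<in> Aut (induced G R)" "\<beta> \<in> Aut (induced G B)" for \<rho> \<beta>
    using hat_eq_iff_compatible[of \<rho> \<beta>] Aut_permutes[OF that(1)] Aut_permutes[OF that(2)]
    by auto
  have "induced_perms image (Aut (induced G B)) \<B> =
      (\<lambda>\<beta>. restrict ((`) \<beta>) \<B>) ` Aut (induced G B)"
    "{hat X \<A> \<phi> | \<phi>. \<phi> \<in> induced_perms act_partition (Aut (induced G R)) \<A>} =
      (\<lambda>\<rho>. hat X \<A> (restrict (act_partition \<rho>) \<A>)) ` Aut (induced G R)"
    by (auto simp: induced_perms_def)
  moreover have "(F ` S = H ` T) \<longleftrightarrow> (\<forall>s\<in>S. \<exists>t\<in>T. F s = H t) \<and> (\<forall>t\<in>T. \<exists>s\<in>S. F s = H t)"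
    for F :: "('v \<Rightarrow> 'v) \<Rightarrow> ('v set \<Rightarrow> 'v set)" and H S T
    by (auto simp: set_eq_iff image_iff; metis)
  ultimately show ?thesis using c by (simp cong: bex_cong ball_cong)
qed

section \<open>Necessity\<close>

context
  assumes uh: "ultrahomogeneous G"
begin

text \<open>The map \<open>f\<close> on \<open>U\<close> together with the identity on
  \<open>W\<close> is an embedding into \<open>G\<close>, because \<open>f\<close> keeps the colors
  of the edges from \<open>W\<close>. Ultrahomogeneity extends it, and the part on \<open>B\<close>
  fixes \<open>W\<close>.\<close>

lemma extend_R:
  assumes "embeds (induced G R) U f" "W \<subseteq> B"
    and "\<And>b r. b \<in> W \<Longrightarrow> r \<in> U \<Longrightarrow> ecol G (b, f r) = ecol G (b, r)"
  obtains \<rho> \<beta> where "\<rho> \<in> Aut (induced G R)" "\<beta> \<in> Aut (induced G B)" "compatible \<rho> \<beta>"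
    "\<And>r. r \<in> U \<Longrightarrow> \<rho> r = f r" "\<And>b. b \<in> W \<Longrightarrow> \<beta> b = b"
proof -
  let ?g = "\<lambda>v. if v \<in> R then f v else v"
  have U: "U \<subseteq> R" using assms(1) by (simp add: embeds_def)
  have i: "(U \<union> W) \<inter> R = U" "(U \<union> W) \<inter> B = W" using U assms(2) disj by blast+
  have "embeds (induced G R) U ?g"
    using assms(1) embeds_cong[of U f ?g "induced G R"] U by (simp add: subset_eq)
  moreover have "embeds (induced G B) W ?g"
    using assms(2) not_R by (auto simp: embeds_def inj_on_def)
  moreover have "\<forall>b\<in>W. \<forall>r\<in>U. ecol G (?g b, ?g r) = ecol G (b, r)"
    using assms(2,3) U not_R by auto
  ultimately have "embeds G (U \<union> W) ?g"
    using U assms(2) by (subst embeds_iff) (auto simp only: i)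
  then obtain \<rho> \<beta> where *: "\<rho> \<in> Aut (induced G R)" "\<beta> \<in> Aut (induced G B)" "compatible \<rho> \<beta>"
    "\<forall>r\<in>U. \<rho> r = ?g r" "\<forall>b\<in>W. \<beta> b = ?g b"
    using uh[unfolded ultrahomogeneous_iff_compatible, rule_format, of "U \<union> W" ?g]
    by (auto simp only: i)
  show thesis
  proof (rule that[OF *(1-3)])
    show "\<rho> r = f r" if "r \<in> U" for r using *(4) that U by auto
    show "\<beta> b = b" if "b \<in> W" for b using *(5) that assms(2) not_R by auto
  qed
qed

text \<open>With a domain inside \<open>B\<close> there are no edges to \<open>R\<close> to respect,
  so \<open>f\<close> is already an embedding for \<open>G\<close>.\<close>

lemma extend_B:
  assumes "embeds (induced G B) W f"
  obtains \<rho> \<beta> where "\<rho> \<in> Aut (induced G R)" "\<beta> \<in> Aut (induced G B)" "compatible \<rho> \<beta>"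
    "\<And>b. b \<in> W \<Longrightarrow> \<beta> b = f b"
proof -
  have i: "W \<inter> R = {}" "W \<inter> B = W" "W \<subseteq> R \<union> B"
    using assms disj by (auto simp: embeds_def)
  have "embeds G W f"
    using assms i by (subst embeds_iff) (auto simp: embeds_def)
  then show thesis
    using uh that i unfolding ultrahomogeneous_iff_compatible by metis
qed

section \<open>The conditions derived from ultrahomogeneity\<close>

lemma ex_compatible_R: "\<rho> \<in> Aut (induced G R) \<Longrightarrow> \<exists>\<beta>\<in>Aut (induced G B). compatible \<rho> \<beta>"
proof -
  assume \<rho>: "\<rho> \<in> Aut (induced G R)"
  obtain \<rho>' \<beta> where *: "\<rho>' \<in> Aut (induced G R)" "\<beta> \<in> Aut (induced G B)" "compatible \<rho>' \<beta>"
    "\<And>r. r \<in> R \<Longrightarrow> \<rho>' r = \<rho> r"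
    by (rule extend_R[of R \<rho> "{}"]) (use Aut_embeds[OF \<rho>, of R] in auto)
  have "\<rho>' = \<rho>"
    using Aut_permutes[OF *(1)] Aut_permutes[OF \<rho>] *(4) by (intro permutes_eqI[of _ R]) simp_all
  with * show ?thesis by blast
qed

lemma ex_compatible_B: "\<beta> \<in> Aut (induced G B) \<Longrightarrow> \<exists>\<rho>\<in>Aut (induced G R). compatible \<rho> \<beta>"
proof -
  assume \<beta>: "\<beta> \<in> Aut (induced G B)"
  obtain \<rho> \<beta>' where *: "\<rho> \<in> Aut (induced G R)" "\<beta>' \<in> Aut (induced G B)" "compatible \<rho> \<beta>'"
    "\<And>b. b \<in> B \<Longrightarrow> \<beta>' b = \<beta> b"
    by (rule extend_B[of B \<beta>]) (use Aut_embeds[OF \<beta>, of B] in auto)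
  \<comment> \<open>Compatibility looks at the second map only on \<open>B\<close>, where
    \<open>\<beta>'\<close> and \<open>\<beta>\<close> agree.\<close>
  then show ?thesis unfolding compatible_def by metis
qed

lemma ultrahomogeneous_R: "ultrahomogeneous (induced G R)"
  unfolding ultrahomogeneous_iff_embeds
proof (intro allI impI)
  fix U f assume "embeds (induced G R) U f"
  then show "\<exists>\<phi>\<in>Aut (induced G R). \<forall>u\<in>U. \<phi> u = f u"
    by (rule extend_R[of U f "{}"]) auto
qed

lemma ultrahomogeneous_B: "ultrahomogeneous (induced G B)"
  unfolding ultrahomogeneous_iff_embeds
proof (intro allI impI)
  fix U f assume "embeds (induced G B) U f"
  then show "\<exists>\<phi>\<in>Aut (induced G B). \<forall>u\<in>U. \<phi> u = f u"
    by (rule extend_B) auto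
qed

text \<open>Compatible partners keep the orbit inside \<open>\<A>\<close>. It is all of
  \<open>\<A>\<close> because any vertex of \<open>B\<close> can be moved to any other by an
  automorphism of \<open>G[B]\<close> that has a compatible partner.\<close>

lemma partition_orbit_nbr_partition:
  assumes "b \<in> B"
  shows "partition_orbit (induced G R) (N b) = \<A>"
proof
  show "partition_orbit (induced G R) (N b) \<subseteq> \<A>"
  proof
    fix P assume "P \<in> partition_orbit (induced G R) (N b)"
    then obtain \<rho> where \<rho>: "\<rho> \<in> Aut (induced G R)" "P = act_partition \<rho> (N b)"
      by (auto simp: partition_orbit_def)
    obtain \<beta> where \<beta>: "\<beta> \<in> Aut (induced G B)" "compatible \<rho> \<beta>"
      using ex_compatible_R[OF \<rho>(1)] by blast
    have "\<beta> b \<in> B" using Aut_permutes[OF \<beta>(1)] assms by (simp add: permutes_in_image)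
    then show "P \<in> \<A>" using \<rho>(2) \<beta>(2) assms by (simp add: compatible_def)
  qed
next
  show "\<A> \<subseteq> partition_orbit (induced G R) (N b)"
  proof
    fix P assume "P \<in> \<A>"
    then obtain b' where b': "b' \<in> B" "P = N b'" by blast
    \<comment> \<open>\<open>B\<close> is monochromatic and a single vertex has no edges, so
      \<open>b\<close> may be sent to any \<open>b'\<close>.\<close>
    have "embeds (induced G B) {b} (\<lambda>_. b')"
      using assms b' vcol_eq_iff[of b' b] not_R by (simp add: embeds_def)
    then obtain \<rho> \<beta> where "\<rho> \<in> Aut (induced G R)" "compatible \<rho> \<beta>" "\<beta> b = b'"
      by (rule extend_B) auto
    then show "P \<in> partition_orbit (induced G R) (N b)"
      using assms b' unfolding partition_orbit_def compatible_def by force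
  qed
qed

text \<open>Preserving part indices for \<open>Ps\<close> means preserving the colors of edges from
  the vertices in \<open>W\<close>. So \<open>f\<close> extends together with the identity on
  \<open>W\<close>, and the resulting \<open>\<rho>\<close> preserves these colors on all of
  \<open>R\<close>.\<close>

lemma ultrahomogeneous_recolor:
  assumes "set Ps \<subseteq> \<A>"
  shows "ultrahomogeneous (recolor (induced G R) Ps)"
  unfolding ultrahomogeneous_iff_embeds
proof (intro allI impI)
  fix U f assume e: "embeds (recolor (induced G R) Ps) U f"
  define W where "W = {b \<in> B. N b \<in> set Ps}"
  have e': "embeds (induced G R) U f"
    and pf: "\<And>P u. P \<in> set Ps \<Longrightarrow> u \<in> U \<Longrightarrow> part_index P (f u) = part_index P u"
    using e by (auto simp: embeds_recolor)
  have U: "U \<subseteq> R" "f ` U \<subseteq> R" using e' by (simp_all add: embeds_def)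
  have "ecol G (b, f r) = ecol G (b, r)" if "b \<in> W" "r \<in> U" for b r
    using pf[of "N b" r] that U part_index_eq_iff[of b r "f r"] by (auto simp: W_def)
  then obtain \<rho> \<beta> where *: "\<rho> \<in> Aut (induced G R)" "\<beta> \<in> Aut (induced G B)"
    "compatible \<rho> \<beta>" "\<And>r. r \<in> U \<Longrightarrow> \<rho> r = f r" "\<And>b. b \<in> W \<Longrightarrow> \<beta> b = b"
    using extend_R[OF e', of W] unfolding W_def by blast
  have p: "\<rho> permutes R" "\<beta> permutes B"
    using Aut_permutes[OF *(1)] Aut_permutes[OF *(2)] by simp_all
  have "part_index P (\<rho> r) = part_index P r" if "P \<in> set Ps" "r \<in> R" for P r
  proof -
    have "P \<in> \<A>" using assms \<open>P \<in> set Ps\<close> by blast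
    then obtain b where b: "b \<in> B" "P = N b" by blast
    then have "\<beta> b = b" using *(5) that(1) by (simp add: W_def)
    then have "ecol G (b, \<rho> r) = ecol G (b, r)"
      using *(3) b(1) that(2) unfolding compatible_iff[OF p] by metis
    then show ?thesis
      using b that(2) part_index_eq_iff[of b r "\<rho> r"] by (simp add: permutes_in_image[OF p(1)])
  qed
  then have "\<rho> \<in> Aut (recolor (induced G R) Ps)" using *(1) by (simp add: Aut_recolor)
  with *(4) show "\<exists>\<phi>\<in>Aut (recolor (induced G R) Ps). \<forall>u\<in>U. \<phi> u = f u" by blast
qed

lemma ultrahomogeneous_system_R: "ultrahomogeneous_system (induced G R) \<A>"
proof -
  obtain b where b: "b \<in> B" using B_nonempty by blast
  show ?thesis
    unfolding ultrahomogeneous_system_def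
    by (rule exI[of _ "N b"])
      (simp add: ordered_partition_nbr_partition b partition_orbit_nbr_partition
        ultrahomogeneous_recolor)
qed

text \<open>A compatible partner makes \<open>\<beta>\<close> send the block of \<open>b\<close> to
  the block of \<open>\<beta> b\<close>, and \<open>\<beta>\<close> permutes
  \<open>B\<close>.\<close>

lemma block_system_B: "block_system B (Aut (induced G B)) \<B>"
  unfolding block_system_def
proof (intro conjI ballI partition_on_blocks)
  fix \<beta> assume \<beta>: "\<beta> \<in> Aut (induced G B)"
  then obtain \<rho> where \<rho>: "\<rho> \<in> Aut (induced G R)" "compatible \<rho> \<beta>"
    using ex_compatible_B by blast
  have p: "\<rho> permutes R" "\<beta> permutes B"
    using Aut_permutes[OF \<rho>(1)] Aut_permutes[OF \<beta>] by simp_all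
  have "(`) \<beta> ` \<B> = (\<lambda>b. X (N b)) ` \<beta> ` B"
    by (simp add: image_image image_nbr_class[OF p \<rho>(2)])
  also have "\<dots> = \<B>" by (simp add: permutes_image[OF p(2)] image_image)
  finally show "(`) \<beta> ` \<B> = \<B>" .
qed

text \<open>Only the inclusion from right to left needs an idea. If \<open>\<beta>\<close> fixes the
  blocks in \<open>\<B>'\<close> setwise, a compatible \<open>\<rho>\<close> fixes their partitions,
  and \<open>\<rho>\<close> can be paired anew with a \<open>\<beta>'\<close> that fixes the blocks
  pointwise.\<close>

lemma easygoing_B: "easygoing (induced G B) \<B>"
  unfolding easygoing_def
proof (intro conjI allI impI)
  show "\<forall>u\<in>verts (induced G B). \<forall>v\<in>verts (induced G B).
      vcol (induced G B) u = vcol (induced G B) v"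
    using vcol_eq_iff not_R by simp
  show "block_system (verts (induced G B)) (Aut (induced G B)) \<B>"
    using block_system_B by simp
  fix \<B>' assume sub: "\<B>' \<subseteq> \<B>"
  let ?fix = "{\<phi> \<in> Aut (induced G B). \<forall>v\<in>\<Union>\<B>'. \<phi> v = v}"
  show "induced_perms image ?fix \<B> =
    {\<sigma> \<in> induced_perms image (Aut (induced G B)) \<B>. \<forall>Y\<in>\<B>'. \<sigma> Y = Y}"
  proof (intro equalityI subsetI)
    fix \<sigma> assume "\<sigma> \<in> induced_perms image ?fix \<B>"
    then obtain \<phi> where \<phi>: "\<phi> \<in> ?fix" "\<sigma> = restrict ((`) \<phi>) \<B>"
      by (auto simp: induced_perms_def)
    have "\<sigma> Y = Y" if "Y \<in> \<B>'" for Y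
    proof -
      have "\<phi> ` Y = id ` Y" using \<phi>(1) that by (intro image_cong) auto
      then show ?thesis using sub that \<phi>(2) by auto
    qed
    then show "\<sigma> \<in> {\<sigma> \<in> induced_perms image (Aut (induced G B)) \<B>. \<forall>Y\<in>\<B>'. \<sigma> Y = Y}"
      using \<phi> by (auto simp: induced_perms_def)
  next
    fix \<sigma> assume "\<sigma> \<in> {\<sigma> \<in> induced_perms image (Aut (induced G B)) \<B>. \<forall>Y\<in>\<B>'. \<sigma> Y = Y}"
    then obtain \<beta> where \<beta>: "\<beta> \<in> Aut (induced G B)" "\<sigma> = restrict ((`) \<beta>) \<B>"
      and fixed: "\<And>Y. Y \<in> \<B>' \<Longrightarrow> \<sigma> Y = Y"
      by (auto simp: induced_perms_def)
    obtain \<rho> where \<rho>: "\<rho> \<in> Aut (induced G R)" "compatible \<rho> \<beta>"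
      using ex_compatible_B[OF \<beta>(1)] by blast
    have p: "\<rho> permutes R" "\<beta> permutes B"
      using Aut_permutes[OF \<rho>(1)] Aut_permutes[OF \<beta>(1)] by simp_all
    have W: "\<Union>\<B>' \<subseteq> B" using sub by (auto simp: nbr_class_def)
    \<comment> \<open>Extending \<open>\<rho>\<close> on all of \<open>R\<close> by the identity on \<open>\<Union>\<B>'\<close> keeps the action on the blocks.\<close>
    have cross: "ecol G (b, \<rho> r) = ecol G (b, r)" if b: "b \<in> \<Union>\<B>'" and r: "r \<in> R" for b r
    proof -
      obtain Y where Y: "Y \<in> \<B>'" "b \<in> Y" using b by blast
      have "b \<in> B" using b W by blast
      have "Y \<in> \<B>" using sub Y(1) by blast
      then have "\<beta> ` Y = Y" using fixed[OF Y(1)] \<beta>(2) by simp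
      then have "\<beta> b \<in> Y" using Y(2) by blast
      moreover obtain b0 where "b0 \<in> B" "Y = X (N b0)" using \<open>Y \<in> \<B>\<close> by blast
      \<comment> \<open>\<open>b\<close> and \<open>\<beta> b\<close> lie in the same block, hence
        have the same partition.\<close>
      ultimately have "N (\<beta> b) = N b" using Y(2) by (simp add: mem_nbr_class)
      then have "act_partition \<rho> (N b) = N b"
        using \<rho>(2) \<open>b \<in> B\<close> by (simp add: compatible_def)
      then show ?thesis using r \<open>b \<in> B\<close> by (simp add: act_nbr_partition_eq_iff[OF p(1)])
    qed
    have "embeds (induced G R) R \<rho>" using Aut_embeds[OF \<rho>(1)] by simp
    then obtain \<rho>' \<beta>' where *: "\<rho>' \<in> Aut (induced G R)" "\<beta>' \<in> Aut (induced G B)"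
      "compatible \<rho>' \<beta>'" "\<And>r. r \<in> R \<Longrightarrow> \<rho>' r = \<rho> r" "\<And>b. b \<in> \<Union>\<B>' \<Longrightarrow> \<beta>' b = b"
      using extend_R[OF _ W cross] by blast
    have "\<rho>' = \<rho>"
      using Aut_permutes[OF *(1)] p(1) *(4) by (intro permutes_eqI[of _ R]) simp_all
    \<comment> \<open>\<open>\<beta>\<close> and \<open>\<beta>'\<close> are compatible with the
      same \<open>\<rho>\<close>, so both induce its \<open>hat\<close> on the blocks.\<close>
    then have "restrict ((`) \<beta>') \<B> = \<sigma>"
      using *(3) \<rho>(2) \<beta>(2) p hat_eq_iff_compatible[of \<rho>] Aut_permutes[OF *(2)]
      by (metis induced_sel(1))
    then show "\<sigma> \<in> induced_perms image ?fix \<B>"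
      using *(2,5) by (auto simp: induced_perms_def)
  qed
qed

end

section \<open>Sufficiency\<close>

text \<open>As \<open>\<tau>\<close> fixes the partitions of the vertices in \<open>W\<close>, its
  partner \<open>\<delta>\<close> fixes their blocks setwise. Easygoingness replaces
  \<open>\<delta>\<close> by a map with the same action on blocks that fixes these blocks pointwise;
  the same action keeps it compatible with \<open>\<tau>\<close>.\<close>

lemma easygoing_fix_pointwise:
  assumes "easygoing (induced G B) \<B>" "\<tau> \<in> Aut (induced G R)" "\<delta> \<in> Aut (induced G B)"
    "compatible \<tau> \<delta>" "W \<subseteq> B" and fixed: "\<And>b. b \<in> W \<Longrightarrow> act_partition \<tau> (N b) = N b"
  obtains \<delta>' where "\<delta>' \<in> Aut (induced G B)" "compatible \<tau> \<delta>'" "\<And>b. b \<in> W \<Longrightarrow> \<delta>' b = b"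
proof -
  define \<B>' where "\<B>' = (\<lambda>b. X (N b)) ` W"
  have p: "\<tau> permutes R" "\<delta> permutes B"
    using Aut_permutes[OF assms(2)] Aut_permutes[OF assms(3)] by simp_all
  have sub: "\<B>' \<subseteq> \<B>" using assms(5) by (auto simp: \<B>'_def)
  have "restrict ((`) \<delta>) \<B> Y = Y" if "Y \<in> \<B>'" for Y
  proof -
    obtain b where b: "b \<in> W" "Y = X (N b)" using \<open>Y \<in> \<B>'\<close> by (auto simp: \<B>'_def)
    have "b \<in> B" using b(1) assms(5) by blast
    then have "\<delta> ` X (N b) = X (N b)"
      using image_nbr_class[OF p assms(4)] fixed[OF b(1)] assms(4) by (simp add: compatible_def)
    then show ?thesis using b(2) \<open>b \<in> B\<close> by auto
  qed
  then have "restrict ((`) \<delta>) \<B> \<in>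
      {\<sigma> \<in> induced_perms image (Aut (induced G B)) \<B>. \<forall>Y\<in>\<B>'. \<sigma> Y = Y}"
    using assms(3) by (auto simp: induced_perms_def)
  moreover have "induced_perms image {\<phi> \<in> Aut (induced G B). \<forall>v\<in>\<Union>\<B>'. \<phi> v = v} \<B> =
      {\<sigma> \<in> induced_perms image (Aut (induced G B)) \<B>. \<forall>Y\<in>\<B>'. \<sigma> Y = Y}"
    using assms(1) sub unfolding easygoing_def by simp
  ultimately have "restrict ((`) \<delta>) \<B> \<in>
      induced_perms image {\<phi> \<in> Aut (induced G B). \<forall>v\<in>\<Union>\<B>'. \<phi> v = v} \<B>"
    by simp
  then obtain \<delta>' where \<delta>': "\<delta>' \<in> Aut (induced G B)" "\<forall>v\<in>\<Union>\<B>'. \<delta>' v = v"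
    "restrict ((`) \<delta>) \<B> = restrict ((`) \<delta>') \<B>"
    by (auto simp: induced_perms_def)
  have "compatible \<tau> \<delta>'"
    using assms(4) \<delta>'(3) p hat_eq_iff_compatible[of \<tau>] Aut_permutes[OF \<delta>'(1)]
    by (metis induced_sel(1))
  moreover have "\<delta>' b = b" if "b \<in> W" for b
    using \<delta>'(2) that assms(5) by (auto simp: \<B>'_def mem_nbr_class)
  ultimately show thesis using that \<delta>'(1) by blast
qed

lemma ultrahomogeneousI:
  assumes uhB: "ultrahomogeneous (induced G B)"
    and sys: "ultrahomogeneous_system (induced G R) \<A>"
    and ex\<rho>: "\<forall>\<beta>\<in>Aut (induced G B). \<exists>\<rho>\<in>Aut (induced G R). compatible \<rho> \<beta>"
    and ex\<beta>: "\<forall>\<rho>\<in>Aut (induced G R). \<exists>\<beta>\<in>Aut (induced G B). compatible \<rho> \<beta>"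
    and easy: "easygoing (induced G B) \<B>"
    and fin: "finite B"
  shows "ultrahomogeneous G"
  unfolding ultrahomogeneous_iff_compatible
proof (intro allI impI)
  fix U f assume e: "embeds G U f"
  define UR where "UR = U \<inter> R"
  define UB where "UB = U \<inter> B"
  have sub: "UR \<subseteq> R" "UB \<subseteq> B" by (auto simp: UR_def UB_def)
  have "U \<subseteq> R \<union> B" using e by (simp add: embeds_def verts_eq)
  then have eR: "embeds (induced G R) UR f" and eB: "embeds (induced G B) UB f"
    and cross: "\<And>b r. b \<in> UB \<Longrightarrow> r \<in> UR \<Longrightarrow> ecol G (f b, f r) = ecol G (b, r)"
    using e embeds_iff[of U f] by (auto simp: UR_def UB_def)
  have fR: "f ` UR \<subseteq> R" using eR by (simp add: embeds_def)
  obtain \<beta> where \<beta>: "\<beta> \<in> Aut (induced G B)" "\<forall>b\<in>UB. \<beta> b = f b"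
    using uhB eB unfolding ultrahomogeneous_iff_embeds by blast
  obtain \<rho> where \<rho>: "\<rho> \<in> Aut (induced G R)" "compatible \<rho> \<beta>" using ex\<rho> \<beta>(1) by blast
  have p: "\<rho> permutes R" "\<beta> permutes B"
    using Aut_permutes[OF \<rho>(1)] Aut_permutes[OF \<beta>(1)] by simp_all
  define h where "h = inv \<rho> \<circ> f"
  have eh: "embeds (induced G R) UR h"
    unfolding h_def using eR fR Aut_embeds[OF Aut_inv[OF \<rho>(1)], of "f ` UR"]
    by (intro embeds_comp) simp_all
  have hR: "h r \<in> R" if "r \<in> UR" for r using eh that by (auto simp: embeds_def)
  have \<rho>h: "\<rho> (h r) = f r" for r by (simp add: h_def permutes_inverses(1)[OF p(1)])
  have ch: "ecol G (b, h r) = ecol G (b, r)" if "b \<in> UB" "r \<in> UR" for b r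
  proof -
    have "b \<in> B" using that(1) sub(2) by blast
    \<comment> \<open>Applying the compatible pair turns the edge from \<open>b\<close> to
      \<open>h r\<close> into the one from \<open>f b\<close> to \<open>f r\<close>, whose color
      \<open>f\<close> preserves.\<close>
    then have "ecol G (b, h r) = ecol G (\<beta> b, \<rho> (h r))"
      using \<rho>(2) hR[OF that(2)] unfolding compatible_iff[OF p] by simp
    then show ?thesis using cross[OF that] \<beta>(2) that(1) by (simp add: \<rho>h)
  qed
  \<comment> \<open>\<open>recolor\<close> takes a list, so the partitions of the vertices in
    \<open>UB\<close> are enumerated, which finiteness of \<open>B\<close> permits.\<close>
  have "finite (N ` UB)" using finite_subset[OF sub(2) fin] by simp
  then obtain Ps where Ps: "set Ps = N ` UB" using finite_list[of "N ` UB"] by metis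
  have "ultrahomogeneous (recolor (induced G R) Ps)"
    using sys Ps sub(2) unfolding ultrahomogeneous_system_def by (metis image_mono)
  moreover have "part_index P (h r) = part_index P r" if "P \<in> set Ps" "r \<in> UR" for P r
  proof -
    obtain b where b: "b \<in> UB" "P = N b" using \<open>P \<in> set Ps\<close> Ps by auto
    have "b \<in> B" "r \<in> R" using b(1) \<open>r \<in> UR\<close> sub by auto
    then show ?thesis
      using ch[OF b(1) \<open>r \<in> UR\<close>] hR[OF \<open>r \<in> UR\<close>] by (simp add: b(2) part_index_eq_iff)
  qed
  then have "embeds (recolor (induced G R) Ps) UR h" using eh by (simp add: embeds_recolor)
  ultimately obtain \<tau> where \<tau>: "\<tau> \<in> Aut (recolor (induced G R) Ps)" "\<forall>r\<in>UR. \<tau> r = h r"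
    unfolding ultrahomogeneous_iff_embeds by blast
  have \<tau>R: "\<tau> \<in> Aut (induced G R)" using \<tau>(1) by (simp add: Aut_recolor)
  have p\<tau>: "\<tau> permutes R" using Aut_permutes[OF \<tau>R] by simp
  have fixed: "act_partition \<tau> (N b) = N b" if "b \<in> UB" for b
  proof -
    have "b \<in> B" using that sub by blast
    \<comment> \<open>Preserving the part indices of \<open>N b\<close> is the same as preserving
      the colors of edges from \<open>b\<close>.\<close>
    moreover have "\<forall>r\<in>R. ecol G (b, \<tau> r) = ecol G (b, r)"
      using \<tau>(1) that \<open>b \<in> B\<close> part_index_eq_iff permutes_in_image[OF p\<tau>]
      by (auto simp: Aut_recolor Ps)
    ultimately show ?thesis by (simp add: act_nbr_partition_eq_iff[OF p\<tau>])
  qed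
  obtain \<delta>0 where "\<delta>0 \<in> Aut (induced G B)" "compatible \<tau> \<delta>0" using ex\<beta> \<tau>R by blast
  then obtain \<delta> where \<delta>: "\<delta> \<in> Aut (induced G B)" "compatible \<tau> \<delta>" "\<And>b. b \<in> UB \<Longrightarrow> \<delta> b = b"
    using easygoing_fix_pointwise[OF easy \<tau>R _ _ sub(2) fixed] by blast
  have p\<delta>: "\<delta> permutes B" using Aut_permutes[OF \<delta>(1)] by simp
  \<comment> \<open>Compatible pairs compose, since both preserve the colors of edges from
    \<open>B\<close> to \<open>R\<close>.\<close>
  have "compatible (\<rho> \<circ> \<tau>) (\<beta> \<circ> \<delta>)"
    using \<rho>(2) \<delta>(2) p p\<tau> p\<delta>
    by (simp add: compatible_iff permutes_compose permutes_in_image)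
  moreover have "\<rho> \<circ> \<tau> \<in> Aut (induced G R)" "\<beta> \<circ> \<delta> \<in> Aut (induced G B)"
    using Aut_comp \<rho>(1) \<tau>R \<beta>(1) \<delta>(1) by blast+
  moreover have "\<forall>r\<in>U \<inter> R. (\<rho> \<circ> \<tau>) r = f r"
    using \<tau>(2) \<rho>h by (simp add: UR_def)
  moreover have "\<forall>b\<in>U \<inter> B. (\<beta> \<circ> \<delta>) b = f b"
    using \<beta>(2) \<delta>(3) by (simp add: UB_def)
  ultimately show "\<exists>\<rho>\<in>Aut (induced G R). \<exists>\<beta>\<in>Aut (induced G B). compatible \<rho> \<beta> \<and>
      (\<forall>r\<in>U \<inter> R. \<rho> r = f r) \<and> (\<forall>b\<in>U \<inter> B. \<beta> b = f b)" by blast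
qed

end

section \<open>From the color classes to the equivalence\<close>

lemma two_class_ccdI:
  assumes "vertex_color_classes G = {R, B}" "R \<noteq> B"
    and "{ecol G (b, r) | b r. b \<in> B \<and> r \<in> R} = {1..l}"
    and "reverse_determined G B R"
  shows "two_class_ccd G R B l"
proof -
  have "R \<in> vertex_color_classes G" "B \<in> vertex_color_classes G" using assms(1) by auto
  \<comment> \<open>\<open>d\<close> is recorded as a color that occurs, which makes
    \<open>B\<close> non-empty.\<close>
  then obtain c d where R: "R = {v \<in> verts G. vcol G v = c}"
    and B: "B = {v \<in> verts G. vcol G v = d}" and "d \<in> vcol G ` verts G"
    by (auto simp: vertex_color_classes_def)
  have cd: "c \<noteq> d" using assms(2) R B by blast
  have "\<Union> (vertex_color_classes G) = verts G" by (auto simp: vertex_color_classes_def)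
  then have V: "verts G = R \<union> B" using assms(1) by simp
  show ?thesis
  proof
    show "verts G = R \<union> B" by (rule V)
    show "R \<inter> B = {}" using R B cd by auto
    show "B \<noteq> {}" using B \<open>d \<in> _\<close> by auto
    show "ecol G (b, r) \<in> {1..l}" if "b \<in> B" "r \<in> R" for b r
      using assms(3) that by blast
    show "vcol G u = vcol G v \<longleftrightarrow> (u \<in> R \<longleftrightarrow> v \<in> R)" if "u \<in> R \<union> B" "v \<in> R \<union> B" for u v
      using that R B cd by auto
    show "reverse_determined G B R" by (rule assms(4))
  qed
qed

theorem mainTheorem3:
  fixes G :: "('v, 'c, nat) ccd"
    and R B :: "'v set"
    and l :: nat
    and \<A> :: "'v set list set"
    and \<B> :: "'v set set"
    and X :: "'v set list \<Rightarrow> 'v set"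
  assumes "is_ccd G"
    and "vertex_color_classes G = {R, B}" and "R \<noteq> B"
    and "{ecol G (b, r) | b r. b \<in> B \<and> r \<in> R} = {1..l}"
    and "reverse_determined G B R"
    and "\<A> = nbr_partition G R l ` B"
    and "X = nbr_class G R B l"
    and "\<B> = X ` \<A>"
  shows "ultrahomogeneous G \<longleftrightarrow>
    (ultrahomogeneous (induced G R) \<and> ultrahomogeneous (induced G B)) \<and>
    ultrahomogeneous_system (induced G R) \<A> \<and>
    block_system B (Aut (induced G B)) \<B> \<and>
    induced_perms image (Aut (induced G B)) \<B> =
      {hat X \<A> \<phi> | \<phi>. \<phi> \<in> induced_perms act_partition (Aut (induced G R)) \<A>} \<and>
    easygoing (induced G B) \<B>"
proof -
  interpret T: two_class_ccd G R B l using assms(2-5) by (rule two_class_ccdI)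
  have fin: "finite B" using assms(1) T.verts_eq by (simp add: is_ccd_def)
  show ?thesis
    \<comment> \<open>Condition (4) becomes the existence of compatible partners on both sides, the
      form in which necessity yields it and sufficiency uses it.\<close>
    unfolding assms(6-8) T.induced_perms_eq_iff
    using T.ultrahomogeneous_R T.ultrahomogeneous_B T.ultrahomogeneous_system_R
      T.block_system_B T.easygoing_B T.ex_compatible_R T.ex_compatible_B
      T.ultrahomogeneousI[OF _ _ _ _ _ fin]
    by blast
qed

end
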